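(* Let $1\le r<\infty$, $B>0$ and $b_1<b_2$. Then there exists $C<\infty$ such that $$\log N_{[\,]}\big(\epsilon,\mathcal{C}([b_1,b_2],[-B,B]),L_r\big)\le C\left(\frac{B(b_2-b_1)^{1/r}}{\epsilon}\right)^{1/2}\quad\text{for all }\epsilon>0.$$
   Context: $\mathcal{C}([b_1,b_2],[-B,B])$ is the class of closed (upper semicontinuous), proper concave functions $\varphi:\mathbb{R}\to[-\infty,\infty)$ whose effective domain $\{x:\varphi(x)>-\infty\}$ is the interval $[b_1,b_2]$ and which satisfy $-B\le\varphi(x)\le B$ for $x\in[b_1,b_2]$. No Lipschitz restriction is imposed. $L_r$ is the $L_r$ distance with respect to Lebesgue measure $\lambda$ on $[b_1,b_2]$: $L_r(f,g)=(\int_{b_1}^{b_2}|f-g|^r\,d\lambda)^{1/r}$. $N_{[\,]}(\epsilon,\mathcal{F},L_r)$ is the minimal number of brackets $[l,u]=\{f:l\le f\le u\text{ on }[b_1,b_2]\}$ with $L_r(l,u)\le\epsilon$ whose union contains $\mathcal{F}$ ($l,u$ need not belong to $\mathcal{F}$). *)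

theory Defs
  imports "HOL-Analysis.Analysis"
begin

text \<open>
  The inequality is the usual one only for functions that never take the value \<open>\<infinity>\<close>, as imposed
  in \<open>proper_concave\<close>; the library convention \<open>0 * (-\<infinity>) = 0\<close> makes the cases \<open>u = 0\<close> and \<open>v = 0\<close>
  trivial.
\<close>

definition ereal_concave :: "('a::real_vector \<Rightarrow> ereal) \<Rightarrow> bool" where
  "ereal_concave \<phi> \<longleftrightarrow>
     (\<forall>x y. \<forall>u\<ge>0. \<forall>v\<ge>0. u + v = 1 \<longrightarrow>
        ereal u * \<phi> x + ereal v * \<phi> y \<le> \<phi> (u *\<^sub>R x + v *\<^sub>R y))"

definition proper_concave :: "('a::real_vector \<Rightarrow> ereal) \<Rightarrow> bool" where
  "proper_concave \<phi> \<longleftrightarrow> ereal_concave \<phi> \<and> (\<forall>x. \<phi> x < \<infinity>) \<and> (\<exists>x. \<phi> x > -\<infinity>)"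

definition upper_semicontinuous :: "('a::topological_space \<Rightarrow> ereal) \<Rightarrow> bool" where
  "upper_semicontinuous \<phi> \<longleftrightarrow> (\<forall>x. \<forall>a>\<phi> x. \<forall>\<^sub>F y in nhds x. \<phi> y < a)"

definition effective_domain :: "('a \<Rightarrow> ereal) \<Rightarrow> 'a set" where
  "effective_domain \<phi> = {x. \<phi> x > -\<infinity>}"

definition concave_class :: "real \<Rightarrow> real \<Rightarrow> real \<Rightarrow> (real \<Rightarrow> ereal) set" where
  "concave_class b1 b2 B =
     {\<phi>. proper_concave \<phi> \<and> upper_semicontinuous \<phi> \<and> effective_domain \<phi> = {b1..b2} \<and>
         (\<forall>x\<in>{b1..b2}. ereal (- B) \<le> \<phi> x \<and> \<phi> x \<le> ereal B)}"

definition Lr_dist :: "real \<Rightarrow> real set \<Rightarrow> (real \<Rightarrow> real) \<Rightarrow> (real \<Rightarrow> real) \<Rightarrow> real" where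
  "Lr_dist r S f g = (LINT x|lebesgue_on S. \<bar>f x - g x\<bar> powr r) powr (1 / r)"

definition bracket :: "real set \<Rightarrow> (real \<Rightarrow> real) \<Rightarrow> (real \<Rightarrow> real) \<Rightarrow> (real \<Rightarrow> ereal) set" where
  "bracket S l u = {f. \<forall>x\<in>S. ereal (l x) \<le> f x \<and> f x \<le> ereal (u x)}"

text \<open>
  Since the Bochner integral of a non-integrable function is \<open>0\<close>, a bound on \<^const>\<open>Lr_dist\<close> is
  meaningful only together with integrability.
\<close>

definition eps_bracket_pair ::
  "real \<Rightarrow> real \<Rightarrow> real set \<Rightarrow> (real \<Rightarrow> real) \<Rightarrow> (real \<Rightarrow> real) \<Rightarrow> bool" where
  "eps_bracket_pair \<epsilon> r S l u \<longleftrightarrow>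
     l \<in> borel_measurable (lebesgue_on S) \<and> u \<in> borel_measurable (lebesgue_on S) \<and>
     integrable (lebesgue_on S) (\<lambda>x. \<bar>l x - u x\<bar> powr r) \<and>
     Lr_dist r S l u \<le> \<epsilon>"

text \<open>The infimum of the empty set is \<open>\<infinity>\<close>: no finite bracketing cover exists.\<close>

definition bracketing_number :: "real \<Rightarrow> real \<Rightarrow> real set \<Rightarrow> (real \<Rightarrow> ereal) set \<Rightarrow> enat" where
  "bracketing_number \<epsilon> r S F =
     Inf {enat (card P) | P. finite P \<and> (\<forall>(l, u)\<in>P. eps_bracket_pair \<epsilon> r S l u) \<and>
                             F \<subseteq> (\<Union>(l, u)\<in>P. bracket S l u)}"

definition ln_enat :: "enat \<Rightarrow> ereal" where
  "ln_enat n = (case n of enat k \<Rightarrow> if k = 0 then -\<infinity> else ereal (ln (real k)) | \<infinity> \<Rightarrow> \<infinity>)"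

end

theory Submission
  imports Defs
begin

text \<open>
  On \<open>[0,1]\<close>, well inside its domain, a concave function with values in \<open>[0,1]\<close> is Lipschitz, so its
  nonnegative Faber-Schauder coefficients on dyadic level \<open>j\<close> have sum at most \<open>2 ^ -j\<close>. Quantising them
  with precision \<open>4 ^ -J * (3/4) ^ |j - J|\<close> determines the function up to a multiple of \<open>4 ^ -J\<close>, and
  counting lists of naturals with bounded sum shows that only \<open>exp (O(2 ^ J))\<close> codes occur: the uniform
  entropy at scale \<open>\<eta>\<close> is \<open>O(\<eta> powr (-1/2))\<close>. Without the Lipschitz bound, apply this at scale
  \<open>\<delta> * 2 powr (a * k)\<close> on the interval \<open>[2 ^ -(k + 1), 2 ^ -k]\<close> and its mirror image. The entropies add
  up to \<open>O(\<delta> powr (-1/2))\<close>, and the error is at most \<open>\<delta> * (x powr (-a) + (1 - x) powr (-a))\<close>, whose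
  \<open>r\<close>-th power is integrable for \<open>a = 1 / (2 * r)\<close>. A bracket is a member of the class plus and
  minus this envelope.
\<close>

section \<open>Covers and their logarithmic size\<close>

text \<open>Entropy is phrased through a relation instead of a metric: \<open>c\<close> bounds the
  logarithm of the number of cells, and any two members of one cell are related. Cells have no
  centres and may stick out of \<open>F\<close>, so refinement and pullback are plain set
  operations.\<close>

definition coverable :: "'a set \<Rightarrow> ('a \<Rightarrow> 'a \<Rightarrow> bool) \<Rightarrow> real \<Rightarrow> bool" where
  "coverable F R c \<longleftrightarrow>
     (\<exists>P. finite P \<and> F \<subseteq> \<Union>P \<and> real (card P) \<le> exp c \<and> (\<forall>A\<in>P. \<forall>f\<in>A. \<forall>g\<in>A. R f g))"

text \<open>Cells pull back to preimages under \<open>T\<close>, whose number cannot grow. This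
  carries entropy bounds along affine changes of variable.\<close>

lemma coverable_pullback:
  assumes "coverable G R c" and "T ` F \<subseteq> G"
    and "\<And>f g. f \<in> F \<Longrightarrow> g \<in> F \<Longrightarrow> R (T f) (T g) \<Longrightarrow> R' f g" and "c \<le> c'"
  shows "coverable F R' c'"
proof -
  obtain P where P: "finite P" "G \<subseteq> \<Union>P" "real (card P) \<le> exp c"
    "\<forall>A\<in>P. \<forall>f\<in>A. \<forall>g\<in>A. R f g"
    using assms(1) unfolding coverable_def by blast
  let ?Q = "(\<lambda>A. T -` A \<inter> F) ` P"
  have "card ?Q \<le> card P" by (rule card_image_le[OF P(1)])
  then have "real (card ?Q) \<le> exp c'"
    using P(3) assms(4) by (meson exp_le_cancel_iff of_nat_le_iff order_trans)
  moreover have "F \<subseteq> \<Union>?Q" using P(2) assms(2) by fastforce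
  ultimately show ?thesis
    unfolding coverable_def using P(1,4) assms(3) by (intro exI[of _ ?Q]) auto
qed

lemma coverable_mono:
  assumes "coverable F R c" and "\<And>f g. f \<in> F \<Longrightarrow> g \<in> F \<Longrightarrow> R f g \<Longrightarrow> R' f g" and "c \<le> c'"
  shows "coverable F R' c'"
  by (rule coverable_pullback[where T = "\<lambda>f. f", OF assms(1)]) (use assms in auto)

lemma coverable_True: "coverable F (\<lambda>_ _. True) 0"
  unfolding coverable_def by (intro exI[of _ "{F}"]) auto

text \<open>The cells of the common refinement are intersections of one cell from each cover;
  cardinalities multiply, hence exponents add.\<close>

lemma coverable_conj:
  assumes "coverable F R c" and "coverable F R' c'"
  shows "coverable F (\<lambda>f g. R f g \<and> R' f g) (c + c')"
proof -
  obtain P where P: "finite P" "F \<subseteq> \<Union>P" "real (card P) \<le> exp c"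
    "\<forall>A\<in>P. \<forall>f\<in>A. \<forall>g\<in>A. R f g"
    using assms(1) unfolding coverable_def by blast
  obtain P' where P': "finite P'" "F \<subseteq> \<Union>P'" "real (card P') \<le> exp c'"
    "\<forall>A\<in>P'. \<forall>f\<in>A. \<forall>g\<in>A. R' f g"
    using assms(2) unfolding coverable_def by blast
  let ?Q = "(\<lambda>(A, A'). A \<inter> A') ` (P \<times> P')"
  have "card ?Q \<le> card P * card P'"
    using card_image_le[of "P \<times> P'" "\<lambda>(A, A'). A \<inter> A'"] P(1) P'(1)
    by (simp add: card_cartesian_product)
  then have "real (card ?Q) \<le> real (card P) * real (card P')"
    by (metis of_nat_le_iff of_nat_mult)
  also have "\<dots> \<le> exp (c + c')"
    unfolding exp_add using P(3) P'(3) by (intro mult_mono) auto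
  finally have "real (card ?Q) \<le> exp (c + c')" .
  moreover have "F \<subseteq> \<Union>?Q"
  proof
    fix f assume "f \<in> F"
    then obtain A A' where "A \<in> P" "f \<in> A" "A' \<in> P'" "f \<in> A'" using P(2) P'(2) by blast
    then show "f \<in> \<Union>?Q" by (intro UnionI[of "A \<inter> A'"]) auto
  qed
  ultimately show ?thesis
    unfolding coverable_def using P(1,4) P'(1,4) by (intro exI[of _ ?Q]) auto
qed

lemma coverable_ball:
  assumes "finite I" and "\<And>i. i \<in> I \<Longrightarrow> coverable F (R i) (c i)"
  shows "coverable F (\<lambda>f g. \<forall>i\<in>I. R i f g) (\<Sum>i\<in>I. c i)"
  using assms
proof (induction I rule: finite_induct)
  case empty
  then show ?case by (simp add: coverable_True)
next
  case (insert i I)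
  have "coverable F (\<lambda>f g. R i f g \<and> (\<forall>i\<in>I. R i f g)) (c i + (\<Sum>i\<in>I. c i))"
    by (intro coverable_conj insert) auto
  then show ?case using insert(1,2) by simp
qed

text \<open>The cells are the fibres of \<open>code\<close>, at most one for each element of
  \<open>K\<close>.\<close>

lemma coverable_code:
  assumes "finite K" and "code ` F \<subseteq> K" and "real (card K) \<le> exp c"
  shows "coverable F (\<lambda>f g. code f = code g) c"
proof -
  have "real (card ((\<lambda>k. code -` {k}) ` K)) \<le> exp c"
    using card_image_le[OF assms(1), of "\<lambda>k. code -` {k}"] assms(3) by linarith
  then show ?thesis
    unfolding coverable_def using assms(1,2)
    by (intro exI[of _ "(\<lambda>k. code -` {k}) ` K"]) auto
qed

subsection \<open>Counting\<close>

text \<open>A single term of the expansion of \<open>(p + (1 - p)) ^ (a + b)\<close> is at most 1.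
  Solving for the binomial coefficient leaves \<open>(1 / p) ^ a * (1 / (1 - p)) ^ b\<close>, where
  \<open>1 / (1 - p) \<le> 1 + 2 * p\<close> because \<open>p \<le> 1/2\<close>. A small
  \<open>p\<close> suits the case of \<open>b\<close> much larger than \<open>a\<close>.\<close>

lemma binomial_le_exp:
  fixes p \<alpha> \<beta> :: real
  assumes "0 < p" "p \<le> 1/2" "real a \<le> \<alpha>" "real b \<le> \<beta>"
  shows "real ((a + b) choose a) \<le> exp (\<alpha> * ln (1/p) + 2 * p * \<beta>)"
proof -
  have "real ((a + b) choose a) * p ^ a * (1 - p) ^ (a + b - a)
          \<le> (\<Sum>k\<le>a + b. real ((a + b) choose k) * p ^ k * (1 - p) ^ (a + b - k))"
    by (rule member_le_sum[where f = "\<lambda>k. real ((a + b) choose k) * p ^ k * (1 - p) ^ (a + b - k)"])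
       (use assms in auto)
  also have "\<dots> = 1" using binomial_ring[of p "1 - p" "a + b"] by simp
  finally have "real ((a + b) choose a) * (p ^ a * (1 - p) ^ b) \<le> 1" by (simp add: mult.assoc)
  moreover have "p ^ a * (1 - p) ^ b > 0" using assms by simp
  ultimately have "real ((a + b) choose a) \<le> 1 / (p ^ a * (1 - p) ^ b)"
    by (simp add: pos_le_divide_eq)
  also have "\<dots> = (1 / p) ^ a * (1 / (1 - p)) ^ b" by (simp add: power_one_over)
  also have "\<dots> \<le> exp (real a * ln (1/p)) * exp (real b * (2 * p))"
  proof (intro mult_mono)
    show "(1 / p) ^ a \<le> exp (real a * ln (1/p))"
      using assms by (simp add: exp_of_nat_mult)
    have "p * p \<le> p * (1/2)" using assms by (intro mult_left_mono) auto
    then have "1 / (1 - p) \<le> 1 + 2 * p" using assms by (simp add: field_simps)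
    also have "\<dots> \<le> exp (2 * p)" by (rule exp_ge_add_one_self)
    finally show "(1 / (1 - p)) ^ b \<le> exp (real b * (2 * p))"
      unfolding exp_of_nat_mult using assms by (intro power_mono) auto
  qed (use assms in auto)
  also have "\<dots> = exp (real a * ln (1/p) + 2 * p * real b)"
    by (simp add: exp_add algebra_simps)
  also have "\<dots> \<le> exp (\<alpha> * ln (1/p) + 2 * p * \<beta>)"
    using assms by (intro exp_le_cancel_iff[THEN iffD2] add_mono mult_right_mono mult_left_mono) auto
  finally show ?thesis .
qed

text \<open>Prepending the slack \<open>M - sum_list xs\<close> gives a list of length
  \<open>Suc n\<close> with sum exactly \<open>M\<close>; those are counted by stars and
  bars.\<close>

lemma bounded_sum_lists:
  fixes n M :: nat
  shows "finite {xs. length xs = n \<and> sum_list xs \<le> M}"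
    and "card {xs. length xs = n \<and> sum_list xs \<le> M} \<le> (n + M) choose n"
proof -
  let ?S = "{xs. length xs = n \<and> sum_list xs \<le> M}"
  let ?T = "{xs. length xs = Suc n \<and> sum_list xs = M}"
  have "finite {xs. set xs \<subseteq> {..M} \<and> length xs = Suc n}"
    by (rule finite_lists_length_eq) simp
  then have fT: "finite ?T"
    by (rule rev_finite_subset) (auto dest: member_le_sum_list)
  have inj: "inj_on (\<lambda>xs. (M - sum_list xs) # xs) ?S" by (rule inj_onI) simp
  have sub: "(\<lambda>xs. (M - sum_list xs) # xs) ` ?S \<subseteq> ?T" by auto
  show "finite ?S" using inj_on_finite[OF inj sub fT] .
  have "card ?S \<le> card ?T" by (rule card_inj_on_le[OF inj sub fT])
  also have "card ?T = (M + n) choose M" by (simp add: card_length_sum_list)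
  also have "\<dots> = (n + M) choose n"
    using binomial_symmetric[of n "n + M"] by (simp add: add.commute)
  finally show "card ?S \<le> (n + M) choose n" .
qed

subsection \<open>Bounded concave functions\<close>

definition unit_concave :: "real set \<Rightarrow> (real \<Rightarrow> real) set" where
  "unit_concave S = {f. concave_on S f \<and> (\<forall>x\<in>S. 0 \<le> f x \<and> f x \<le> 1)}"

lemma unit_concave_diff_le_1:
  assumes "f \<in> unit_concave S" "g \<in> unit_concave S" "x \<in> S"
  shows "\<bar>f x - g x\<bar> \<le> 1"
proof -
  have "0 \<le> f x" "f x \<le> 1" "0 \<le> g x" "g x \<le> 1" using assms by (auto simp: unit_concave_def)
  then show ?thesis by linarith
qed

lemma concave_on_affine:
  fixes f :: "real \<Rightarrow> real"
  assumes "concave_on A f" and "convex S" and "\<And>t. t \<in> S \<Longrightarrow> c + m * t \<in> A"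
  shows "concave_on S (\<lambda>t. f (c + m * t))"
  unfolding concave_on_iff
proof (intro conjI ballI allI impI)
  fix x y u v :: real
  assume *: "x \<in> S" "y \<in> S" "0 \<le> u" "0 \<le> v" "u + v = 1"
  have "c + m * (u *\<^sub>R x + v *\<^sub>R y) = (u + v) * c + m * (u * x + v * y)" using *(5) by simp
  also have "\<dots> = u *\<^sub>R (c + m * x) + v *\<^sub>R (c + m * y)" by (simp add: algebra_simps)
  finally have "c + m * (u *\<^sub>R x + v *\<^sub>R y) = u *\<^sub>R (c + m * x) + v *\<^sub>R (c + m * y)" .
  then show "u * f (c + m * x) + v * f (c + m * y) \<le> f (c + m * (u *\<^sub>R x + v *\<^sub>R y))"
    using assms(1,3) * unfolding concave_on_iff by simp
qed (rule assms)

lemma unit_concave_affine: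
  assumes "f \<in> unit_concave A" and "convex S" and "\<And>t. t \<in> S \<Longrightarrow> c + m * t \<in> A"
  shows "(\<lambda>t. f (c + m * t)) \<in> unit_concave S"
  using assms concave_on_affine[of A f S c m] unfolding unit_concave_def by auto

text \<open>The margins of length 1 on both sides of \<open>{0..1}\<close> do the work:
  \<open>x\<close> lies between -1 and \<open>y\<close>, and \<open>f (-1) \<ge> 0\<close> forces
  \<open>f x\<close> to be at least the fraction \<open>(x + 1) / (y + 1)\<close> of
  \<open>f y\<close>. As \<open>f y \<le> 1\<close>, the rise is at most \<open>y - x\<close>; the
  point 2 bounds the fall in the same way.\<close>

lemma unit_concave_lipschitz:
  assumes "f \<in> unit_concave {-1..2}" and "0 \<le> x" "x \<le> y" "y \<le> 1"
  shows "\<bar>f y - f x\<bar> \<le> y - x"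
proof -
  have f: "concave_on {-1..2} f" "\<And>z. z \<in> {-1..2} \<Longrightarrow> 0 \<le> f z \<and> f z \<le> 1"
    using assms(1) by (auto simp: unit_concave_def)
  have "(y - x) / (y + 1) * f (-1) + (x + 1) / (y + 1) * f y
          \<le> f (((y - x) / (y + 1)) *\<^sub>R (-1) + ((x + 1) / (y + 1)) *\<^sub>R y)"
    using assms
    by (intro f(1)[unfolded concave_on_iff, THEN conjunct2, rule_format])
       (auto simp: add_divide_distrib[symmetric])
  also have "((y - x) / (y + 1)) *\<^sub>R (-1) + ((x + 1) / (y + 1)) *\<^sub>R y = x * ((y + 1) / (y + 1))"
    by (simp only: real_scaleR_def times_divide_eq_left times_divide_eq_right
          add_divide_distrib[symmetric]) (simp add: algebra_simps)
  also have "\<dots> = x" using assms by simp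
  finally have "(x + 1) / (y + 1) * f y \<le> f x"
    using assms f(2)[of "-1"] by (smt (verit) atLeastAtMost_iff divide_nonneg_nonneg mult_nonneg_nonneg)
  then have "f y - f x \<le> f y - (x + 1) / (y + 1) * f y" by simp
  also have "\<dots> = (y - x) * (f y / (y + 1))"
    using assms by (simp add: field_simps)
  also have "\<dots> \<le> (y - x) * 1"
    using assms f(2)[of y] by (intro mult_left_mono) auto
  finally have 1: "f y - f x \<le> y - x" by simp
  have "(2 - y) / (2 - x) * f x + (y - x) / (2 - x) * f 2
          \<le> f (((2 - y) / (2 - x)) *\<^sub>R x + ((y - x) / (2 - x)) *\<^sub>R 2)"
    using assms
    by (intro f(1)[unfolded concave_on_iff, THEN conjunct2, rule_format])
       (auto simp: add_divide_distrib[symmetric])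
  also have "((2 - y) / (2 - x)) *\<^sub>R x + ((y - x) / (2 - x)) *\<^sub>R 2 = y * ((2 - x) / (2 - x))"
    by (simp only: real_scaleR_def times_divide_eq_left times_divide_eq_right
          add_divide_distrib[symmetric]) (simp add: algebra_simps)
  also have "\<dots> = y" using assms by simp
  finally have "(2 - y) / (2 - x) * f x \<le> f y"
    using assms f(2)[of 2] by (smt (verit) atLeastAtMost_iff divide_nonneg_nonneg mult_nonneg_nonneg)
  then have "f x - f y \<le> f x - (2 - y) / (2 - x) * f x" by simp
  also have "\<dots> = (y - x) * (f x / (2 - x))"
    using assms by (simp add: field_simps)
  also have "\<dots> \<le> (y - x) * 1"
    using assms f(2)[of x] by (intro mult_left_mono) auto
  finally have 2: "f x - f y \<le> y - x" by simp
  from 1 2 show ?thesis by linarith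
qed

subsection \<open>Faber-Schauder coefficients of concave functions\<close>

text \<open>The coefficient of the hat function over the \<open>i\<close>-th dyadic interval of
  level \<open>j\<close>: midpoint value minus linear interpolation.\<close>

definition schauder :: "nat \<Rightarrow> nat \<Rightarrow> (real \<Rightarrow> real) \<Rightarrow> real" where
  "schauder j i f =
     f (real (2 * i + 1) / 2 ^ Suc j) - (f (real i / 2 ^ j) + f (real (Suc i) / 2 ^ j)) / 2"

lemma unit_concave_midpoint:
  assumes "f \<in> unit_concave {-1..2}" and "x \<in> {-1..2}" "y \<in> {-1..2}"
  shows "(f x + f y) / 2 \<le> f ((x + y) / 2)"
proof -
  have c: "concave_on {-1..2} f" using assms by (simp add: unit_concave_def)
  have "(1/2) * f x + (1/2) * f y \<le> f ((1/2) *\<^sub>R x + (1/2) *\<^sub>R y)"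
    using assms(2,3) by (intro c[unfolded concave_on_iff, THEN conjunct2, rule_format]) auto
  then show ?thesis by (simp add: add_divide_distrib)
qed

lemma schauder_nonneg:
  assumes "f \<in> unit_concave {-1..2}" and "i < 2 ^ j"
  shows "0 \<le> schauder j i f"
proof -
  have "real (Suc i) \<le> 2 ^ j"
    using assms(2) by (metis Suc_leI of_nat_le_iff of_nat_numeral of_nat_power)
  then have "real i / 2 ^ j \<in> {-1..2}" "real (Suc i) / 2 ^ j \<in> {-1..2}"
    by (auto simp: field_simps)
  from unit_concave_midpoint[OF assms(1) this]
  have "(f (real i / 2 ^ j) + f (real (Suc i) / 2 ^ j)) / 2
          \<le> f ((real i / 2 ^ j + real (Suc i) / 2 ^ j) / 2)" .
  also have "(real i / 2 ^ j + real (Suc i) / 2 ^ j) / 2 = real (2 * i + 1) / 2 ^ Suc j"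
    by (simp add: field_simps)
  finally show ?thesis by (simp add: schauder_def)
qed

text \<open>By concavity the second differences of \<open>f\<close> have one sign, so they telescope into a
  difference of slopes.\<close>

lemma sum_schauder_le:
  assumes f: "f \<in> unit_concave {-1..2}"
  shows "(\<Sum>i<2 ^ j. schauder j i f) \<le> 1 / 2 ^ j"
proof -
  define N :: real where "N = 2 ^ Suc j"
  \<comment> \<open>These are the increments on the grid of half the spacing; twice a coefficient is
    the drop between the two increments inside its interval.\<close>
  define t where "t k = f (real (Suc k) / N) - f (real k / N)" for k
  have N: "N > 0" by (simp add: N_def)
  have sch: "2 * schauder j i f = t (2 * i) - t (2 * i + 1)" for i
  proof -
    have "real i / 2 ^ j = real (2 * i) / N" "real (Suc i) / 2 ^ j = real (Suc (2 * i + 1)) / N"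
      by (simp_all add: N_def field_simps)
    then have "schauder j i f
        = f (real (2 * i + 1) / N) - (f (real (2 * i) / N) + f (real (Suc (2 * i + 1)) / N)) / 2"
      unfolding schauder_def N_def[symmetric] by (simp only:)
    then show ?thesis by (simp add: t_def add_divide_distrib)
  qed
  have anti: "t (Suc k) \<le> t k" if "real (Suc (Suc k)) \<le> N" for k
  proof -
    have "real k / N \<in> {-1..2}" "real (Suc (Suc k)) / N \<in> {-1..2}"
      using that N by (auto simp: field_simps)
    from unit_concave_midpoint[OF f this]
    have "f (real k / N) + f (real (Suc (Suc k)) / N)
            \<le> 2 * f ((real k / N + real (Suc (Suc k)) / N) / 2)" by simp
    also have "(real k / N + real (Suc (Suc k)) / N) / 2 = real (Suc k) / N"
      using N by (simp add: field_simps)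
    finally show ?thesis by (simp add: t_def)
  qed
  \<comment> \<open>The sum contains only the drops inside the intervals. Those across interval
    boundaries are nonnegative by \<open>anti\<close>, so adding them and telescoping gives an upper
    bound.\<close>
  have tele: "(\<Sum>i<Suc m. t (2 * i) - t (2 * i + 1)) \<le> t 0 - t (2 * m + 1)"
    if "real (2 * m + 2) \<le> N" for m
    using that
  proof (induction m)
    case (Suc m)
    have "t (Suc (2 * m + 1)) \<le> t (2 * m + 1)" by (rule anti) (use Suc.prems in simp)
    with Suc show ?case by simp
  qed simp
  have lip: "\<bar>t k\<bar> \<le> 1 / N" if "real (Suc k) \<le> N" for k
  proof -
    have "\<bar>f (real (Suc k) / N) - f (real k / N)\<bar> \<le> real (Suc k) / N - real k / N"
      using that N by (intro unit_concave_lipschitz[OF f]) (auto simp: field_simps)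
    then show ?thesis using N by (simp add: t_def field_simps)
  qed
  \<comment> \<open>With this \<open>m\<close> the last increment has index
    \<open>2 * m + 1\<close>, which is \<open>N - 1\<close>, and ends at the point 1.\<close>
  define m :: nat where "m = 2 ^ j - 1"
  have m: "Suc m = 2 ^ j" by (simp add: m_def)
  then have "real (Suc m) = 2 ^ j" by (metis of_nat_numeral of_nat_power)
  then have mN: "real (2 * m + 2) = N" by (simp add: N_def)
  have "2 * (\<Sum>i<2 ^ j. schauder j i f) = (\<Sum>i<Suc m. t (2 * i) - t (2 * i + 1))"
    unfolding m by (simp add: sum_distrib_left sch)
  also have "\<dots> \<le> t 0 - t (2 * m + 1)" by (rule tele[OF mN[THEN eq_refl]])
  also have "\<dots> \<le> 2 / N" using lip[of 0] lip[of "2 * m + 1"] mN by auto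
  finally have "2 * (\<Sum>i<2 ^ j. schauder j i f) \<le> 1 / 2 ^ j" by (simp add: N_def)
  moreover have "0 \<le> 1 / (2::real) ^ j" by simp
  ultimately show ?thesis by linarith
qed

section \<open>Quantised coefficients and the number of codes per level\<close>

text \<open>On level \<open>j\<close> there are \<open>2 ^ j\<close> quantised coefficients with sum at most \<open>1 / (2 ^ j * mesh)\<close>.
  At the critical level \<open>J\<close> both numbers are \<open>2 ^ J\<close>; away from it the smaller one decays
  geometrically, which leaves room to refine the mesh so that the errors of all levels are summable.\<close>

definition level_dist :: "nat \<Rightarrow> nat \<Rightarrow> nat" where
  "level_dist J j = (J - j) + (j - J)"

text \<open>The ratio \<open>3/4\<close> is below 1, so the meshes sum to a multiple of
  \<open>(1/4) ^ J\<close>. It exceeds \<open>1/2\<close>, so \<open>1 / (2 ^ j * mesh J j)\<close>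
  still decays geometrically above level \<open>J\<close>, with ratio \<open>2/3\<close>.\<close>

definition mesh :: "nat \<Rightarrow> nat \<Rightarrow> real" where
  "mesh J j = (1/4) ^ J * (3/4) ^ level_dist J j"

lemma mesh_pos: "mesh J j > 0"
  by (simp add: mesh_def)

text \<open>Nonnegativity keeps \<open>nat\<close> from merging negative floors, so equal codes mean
  equal floors and quotients at most 1 apart.\<close>

lemma eq_nat_floor_divide_imp:
  fixes x y e :: real
  assumes "0 < e" "0 \<le> x" "0 \<le> y" "nat \<lfloor>x / e\<rfloor> = nat \<lfloor>y / e\<rfloor>"
  shows "\<bar>x - y\<bar> \<le> e"
proof -
  have "0 \<le> \<lfloor>x / e\<rfloor>" "0 \<le> \<lfloor>y / e\<rfloor>" using assms by auto
  then have "\<lfloor>x / e\<rfloor> = \<lfloor>y / e\<rfloor>" using assms(4) by linarith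
  then have "\<bar>x / e - y / e\<bar> \<le> 1" by linarith
  then have "\<bar>(x - y) / e\<bar> \<le> 1" by (simp add: diff_divide_distrib)
  then show ?thesis using assms(1) by (simp add: abs_divide)
qed

text \<open>One of \<open>n\<close> and \<open>M\<close> is at most
  \<open>2 ^ J * (2/3) ^ k\<close>, the other at most \<open>2 ^ J * (8/3) ^ k\<close>: below
  \<open>J\<close> there are few coefficients, above \<open>J\<close> their total is small. The
  small entry pays the factor \<open>ln (1/p)\<close>, which is linear in \<open>k\<close>.\<close>

lemma binomial_level_le_exp:
  assumes n: "real n \<le> 2 ^ j" and M: "real M \<le> 1 / (2 ^ j * mesh J j)"
  defines "k \<equiv> level_dist J j"
  shows "real ((n + M) choose n) \<le> exp (3 * 2 ^ J * (real k + 1) * (2/3) ^ k)"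
proof -
  \<comment> \<open>With this \<open>p\<close> the large entry costs
    \<open>2 * p * (2 ^ J * (8/3) ^ k) = 2 ^ J * (1/3) ^ k\<close>, which is below the bound for the
    small one.\<close>
  define p :: real where "p = (1/8) ^ k / 2"
  have p: "0 < p" "p \<le> 1/2" by (auto simp: p_def power_le_one)
  have main: "real ((a + b) choose a) \<le> exp (3 * 2 ^ J * (real k + 1) * (2/3) ^ k)"
    if "real a \<le> 2 ^ J * (2/3) ^ k" "real b \<le> 2 ^ J * (8/3) ^ k" for a b
  proof -
    have "1 / p = 2 * 2 ^ (3 * k)"
      by (simp add: p_def power_mult power_one_over)
    then have "ln (1 / p) = (3 * real k + 1) * ln 2"
      by (simp add: ln_mult ln_realpow algebra_simps)
    also have "\<dots> \<le> (3 * real k + 1) * 1" using ln_2_less_1 by (intro mult_left_mono) auto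
    finally have l: "ln (1 / p) \<le> 3 * real k + 1" by simp
    have "2 * p * (2 ^ J * (8/3) ^ k) = 2 ^ J * ((1/8) ^ k * (8/3) ^ k)" by (simp add: p_def)
    also have "(1/8) ^ k * (8/3::real) ^ k = (1/3) ^ k" by (simp flip: power_mult_distrib)
    also have "2 ^ J * (1/3::real) ^ k \<le> 2 ^ J * (2/3) ^ k"
      by (intro mult_left_mono power_mono) auto
    finally have r: "2 * p * (2 ^ J * (8/3) ^ k) \<le> 2 ^ J * (2/3) ^ k" .
    have "2 ^ J * (2/3) ^ k * ln (1/p) \<le> 2 ^ J * (2/3) ^ k * (3 * real k + 1)"
      using l by (intro mult_left_mono) auto
    then have "2 ^ J * (2/3) ^ k * ln (1/p) + 2 * p * (2 ^ J * (8/3) ^ k)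
          \<le> 2 ^ J * (2/3) ^ k * (3 * real k + 1) + 2 ^ J * (2/3) ^ k" using r by linarith
    also have "\<dots> = 2 ^ J * (2/3) ^ k * (3 * real k + 2)" by (simp add: algebra_simps)
    also have "\<dots> \<le> 2 ^ J * (2/3) ^ k * (3 * (real k + 1))" by (intro mult_left_mono) auto
    also have "\<dots> = 3 * 2 ^ J * (real k + 1) * (2/3) ^ k" by simp
    finally show ?thesis using binomial_le_exp[OF p that] by (meson exp_le_cancel_iff order_trans)
  qed
  show ?thesis
  proof (cases "j \<le> J")
    case True
    then have k: "J = j + k" by (simp add: k_def level_dist_def)
    have "real n \<le> 2 ^ J * (1/2) ^ k" using n by (simp add: k power_add power_one_over)
    also have "\<dots> \<le> 2 ^ J * (2/3) ^ k" by (intro mult_left_mono power_mono) auto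
    finally have 1: "real n \<le> 2 ^ J * (2/3) ^ k" .
    have e: "(8::real) ^ k = 2 ^ k * 4 ^ k" "(4::real) ^ j = 2 ^ j * 2 ^ j"
      by (simp_all flip: power_mult_distrib)
    have "1 / (2 ^ j * mesh J j) = 2 ^ J * (8/3) ^ k * (2 / 2) ^ k"
      unfolding mesh_def k_def[symmetric] unfolding k power_add power_divide e
      by (simp add: field_simps flip: power_mult_distrib)
    then have 2: "real M \<le> 2 ^ J * (8/3) ^ k" using M by simp
    show ?thesis by (rule main[OF 1 2])
  next
    case False
    then have k: "j = J + k" by (simp add: k_def level_dist_def)
    have "real n \<le> 2 ^ J * 2 ^ k" using n by (simp add: k power_add)
    also have "\<dots> \<le> 2 ^ J * (8/3) ^ k" by (intro mult_left_mono power_mono) auto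
    finally have 1: "real n \<le> 2 ^ J * (8/3) ^ k" .
    have e: "(4::real) ^ k = 2 ^ k * 2 ^ k" "(4::real) ^ J = 2 ^ J * 2 ^ J"
      by (simp_all flip: power_mult_distrib)
    have "1 / (2 ^ j * mesh J j) = 2 ^ J * (2/3) ^ k"
      unfolding mesh_def k_def[symmetric] unfolding k power_add power_divide e
      by (simp add: field_simps)
    then have 2: "real M \<le> 2 ^ J * (2/3) ^ k" using M by simp
    \<comment> \<open>Here \<open>M\<close> is the small entry; the symmetry of the binomial
      coefficient puts it in the first place.\<close>
    have "(n + M) choose n = (M + n) choose M"
      using binomial_symmetric[of n "n + M"] by (simp add: add.commute)
    then show ?thesis using main[OF 2 1] by simp
  qed
qed

text \<open>Rounding down only lowers the total, so by \<open>sum_schauder_le\<close> the code is a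
  list of \<open>2 ^ j\<close> naturals with sum at most \<open>M\<close>. Equal codes put
  corresponding coefficients within one mesh.\<close>

lemma coverable_level:
  fixes J j :: nat
  defines "k \<equiv> level_dist J j"
  shows "coverable (unit_concave {-1..2})
           (\<lambda>f g. \<forall>i<2 ^ j. \<bar>schauder j i f - schauder j i g\<bar> \<le> mesh J j)
           (3 * 2 ^ J * (real k + 1) * (2/3) ^ k)"
proof -
  define M where "M = nat \<lfloor>1 / (2 ^ j * mesh J j)\<rfloor>"
  define n :: nat where "n = 2 ^ j"
  define code where "code f = map (\<lambda>i. nat \<lfloor>schauder j i f / mesh J j\<rfloor>) [0..<n]" for f
  let ?K = "{xs. length xs = n \<and> sum_list xs \<le> M}"
  have M: "real M \<le> 1 / (2 ^ j * mesh J j)"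
    using mesh_pos[of J j] by (simp add: M_def)
  have "real (card ?K) \<le> real ((n + M) choose n)"
    using bounded_sum_lists(2)[of n M] by linarith
  also have "\<dots> \<le> exp (3 * 2 ^ J * (real k + 1) * (2/3) ^ k)"
    unfolding k_def by (rule binomial_level_le_exp[OF _ M]) (simp add: n_def)
  finally have card: "real (card ?K) \<le> exp (3 * 2 ^ J * (real k + 1) * (2/3) ^ k)" .
  have sub: "code ` unit_concave {-1..2} \<subseteq> ?K"
  proof (intro image_subsetI CollectI conjI)
    fix f assume f: "f \<in> unit_concave {-1..2}"
    have "real (sum_list (code f)) = (\<Sum>i<n. real (nat \<lfloor>schauder j i f / mesh J j\<rfloor>))"
      unfolding code_def by (simp add: sum_list_distinct_conv_sum_set atLeast0LessThan)
    also have "\<dots> \<le> (\<Sum>i<n. schauder j i f / mesh J j)"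
      using schauder_nonneg[OF f, of _ j] mesh_pos[of J j]
      by (intro sum_mono) (simp add: n_def)
    also have "\<dots> = (\<Sum>i<2 ^ j. schauder j i f) / mesh J j"
      by (simp add: n_def sum_divide_distrib)
    also have "\<dots> \<le> 1 / 2 ^ j / mesh J j"
      using sum_schauder_le[OF f] mesh_pos[of J j] by (intro divide_right_mono) auto
    finally show "sum_list (code f) \<le> M" by (simp add: M_def le_nat_floor)
  qed (simp add: code_def)
  show ?thesis
  proof (rule coverable_mono[OF coverable_code[OF bounded_sum_lists(1) sub card]])
    fix f g assume fg: "f \<in> unit_concave {-1..2}" "g \<in> unit_concave {-1..2}" "code f = code g"
    show "\<forall>i<2 ^ j. \<bar>schauder j i f - schauder j i g\<bar> \<le> mesh J j"
    proof (intro allI impI)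
      fix i :: nat assume "i < 2 ^ j"
      then have "nat \<lfloor>schauder j i f / mesh J j\<rfloor> = nat \<lfloor>schauder j i g / mesh J j\<rfloor>"
        using fg(3) unfolding code_def n_def by simp
      then show "\<bar>schauder j i f - schauder j i g\<bar> \<le> mesh J j"
        using schauder_nonneg fg(1,2) \<open>i < 2 ^ j\<close> mesh_pos by (intro eq_nat_floor_divide_imp) auto
    qed
  qed simp
qed

text \<open>Each distance from \<open>J\<close> is attained by at most two levels, one below
  \<open>J\<close> and one not below it.\<close>

lemma sum_level_dist_le:
  fixes \<phi> :: "nat \<Rightarrow> real"
  assumes "\<And>k. 0 \<le> \<phi> k" and "\<And>n. (\<Sum>k<n. \<phi> k) \<le> c"
  shows "(\<Sum>j<m. \<phi> (level_dist J j)) \<le> 2 * c"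
proof -
  have "(\<Sum>j<m. \<phi> (level_dist J j)) \<le> (\<Sum>j\<in>{..<J} \<union> {J..<J + m}. \<phi> (level_dist J j))"
    by (intro sum_mono2) (auto simp: assms)
  also have "\<dots> = (\<Sum>j<J. \<phi> (level_dist J j)) + (\<Sum>j\<in>{J..<J + m}. \<phi> (level_dist J j))"
    by (intro sum.union_disjoint) auto
  also have "(\<Sum>j<J. \<phi> (level_dist J j)) = (\<Sum>j<J. \<phi> (Suc (J - Suc j)))"
    by (intro sum.cong) (auto simp: level_dist_def Suc_diff_Suc)
  also have "\<dots> = (\<Sum>k<J. \<phi> (Suc k))" by (rule sum.nat_diff_reindex)
  also have "\<dots> \<le> (\<Sum>k<Suc J. \<phi> k)" by (subst sum.lessThan_Suc_shift) (simp add: assms)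
  also have "(\<Sum>j\<in>{J..<J + m}. \<phi> (level_dist J j)) = (\<Sum>k<m. \<phi> k)"
    by (rule sum.reindex_bij_witness[of _ "\<lambda>k. k + J" "\<lambda>j. j - J"]) (auto simp: level_dist_def)
  finally show ?thesis using assms(2)[of "Suc J"] assms(2)[of m] by linarith
qed

section \<open>Reconstruction from the coefficients and uniform entropy\<close>

text \<open>Induction on the level: an even grid point already lies on the coarser grid, and at an
  odd one the value is the mean of its two neighbours plus a coefficient, so level \<open>m\<close>
  adds at most \<open>\<eta> m\<close> to the error.\<close>

lemma dyadic_reconstruction:
  assumes "\<bar>f 0 - g 0\<bar> \<le> e" "\<bar>f 1 - g 1\<bar> \<le> e"
    and "\<And>j i. j < m \<Longrightarrow> i < 2 ^ j \<Longrightarrow> \<bar>schauder j i f - schauder j i g\<bar> \<le> \<eta> j"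
    and "\<And>j. 0 \<le> \<eta> j" and "i \<le> 2 ^ m"
  shows "\<bar>f (real i / 2 ^ m) - g (real i / 2 ^ m)\<bar> \<le> e + (\<Sum>j<m. \<eta> j)"
  using assms(3,5)
proof (induction m arbitrary: i)
  case 0
  then have "i = 0 \<or> i = 1" by auto
  then show ?case using assms(1,2) by auto
next
  case (Suc m)
  have IH: "\<bar>f (real i / 2 ^ m) - g (real i / 2 ^ m)\<bar> \<le> e + (\<Sum>j<m. \<eta> j)" if "i \<le> 2 ^ m" for i
    using Suc that by auto
  show ?case
  proof (cases "even i")
    case True
    then obtain l where l: "i = 2 * l" by (elim evenE)
    then have "\<bar>f (real l / 2 ^ m) - g (real l / 2 ^ m)\<bar> \<le> e + (\<Sum>j<m. \<eta> j)"
      using Suc.prems(2) by (intro IH) simp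
    moreover have "real i / 2 ^ Suc m = real l / 2 ^ m" by (simp add: l)
    ultimately show ?thesis using assms(4)[of m] by simp
  next
    case False
    then obtain l where l: "i = 2 * l + 1" by (elim oddE)
    then have "l < 2 ^ m" using Suc.prems(2) by simp
    then have "\<bar>f (real l / 2 ^ m) - g (real l / 2 ^ m)\<bar> \<le> e + (\<Sum>j<m. \<eta> j)"
      "\<bar>f (real (Suc l) / 2 ^ m) - g (real (Suc l) / 2 ^ m)\<bar> \<le> e + (\<Sum>j<m. \<eta> j)"
      by (intro IH; simp)+
    moreover have "\<bar>schauder m l f - schauder m l g\<bar> \<le> \<eta> m"
      using Suc.prems(1) \<open>l < 2 ^ m\<close> by simp
    ultimately show ?thesis unfolding schauder_def l[symmetric] by (simp add: field_simps)
  qed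
qed

text \<open>With \<open>e = (1/4) ^ J\<close>, the error 11 is 1 for the end values, 8 for all
  levels, and 1 each for moving \<open>f\<close> and \<open>g\<close> to a grid point. The exponent
  58 is 4 for the end values plus \<open>3 * (2 * 9)\<close> for the levels. Levels below
  \<open>2 * J\<close> suffice since the final spacing is \<open>e\<close>.\<close>

lemma coverable_uniform_dyadic:
  "coverable (unit_concave {-1..2}) (\<lambda>f g. \<forall>x\<in>{0..1}. \<bar>f x - g x\<bar> \<le> 11 * (1/4) ^ J) (58 * 2 ^ J)"
proof -
  let ?G = "unit_concave {-1..2}"
  define e :: real where "e = (1/4) ^ J"
  have e: "0 < e" by (simp add: e_def)
  define code where "code f = (nat \<lfloor>f 0 / e\<rfloor>, nat \<lfloor>f 1 / e\<rfloor>)" for f :: "real \<Rightarrow> real"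
  have "coverable ?G (\<lambda>f g. code f = code g) (4 * 2 ^ J)"
  proof (rule coverable_code)
    show "finite ({..4 ^ J :: nat} \<times> {..4 ^ J :: nat})" by simp
    have "nat \<lfloor>f x / e\<rfloor> \<le> 4 ^ J" if "f \<in> ?G" "x = 0 \<or> x = 1" for f x
    proof -
      have "f x \<le> 1" using that by (auto simp: unit_concave_def)
      then have "f x / e \<le> 4 ^ J" by (simp add: e_def power_one_over)
      then have "\<lfloor>f x / e\<rfloor> \<le> 4 ^ J" by (simp add: floor_le_iff)
      then show ?thesis by (simp add: nat_le_iff)
    qed
    then show "code ` ?G \<subseteq> {..4 ^ J} \<times> {..4 ^ J}" by (auto simp: code_def)
    \<comment> \<open>Each end value has \<open>1 + 4 ^ J\<close> codes, at most
      \<open>(1 + 2 ^ J)\<^sup>2\<close>; thus even this mesh costs only a multiple of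
      \<open>2 ^ J\<close>.\<close>
    have "1 + (4::real) ^ J = 1 + (2 ^ J)\<^sup>2" by (simp add: power2_eq_square flip: power_mult_distrib)
    also have "\<dots> \<le> (1 + 2 ^ J)\<^sup>2" by (simp add: power2_sum)
    also have "\<dots> \<le> (exp (2 ^ J))\<^sup>2" by (intro power_mono exp_ge_add_one_self) auto
    also have "\<dots> = exp (2 * 2 ^ J)" by (simp add: exp_double)
    finally have "(1 + (4::real) ^ J) * (1 + 4 ^ J) \<le> exp (2 * 2 ^ J) * exp (2 * 2 ^ J)"
      by (intro mult_mono) auto
    then show "real (card ({..4 ^ J :: nat} \<times> {..4 ^ J :: nat})) \<le> exp (4 * 2 ^ J)"
      by (simp add: card_cartesian_product algebra_simps flip: exp_add)
  qed
  moreover have "coverable ?G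
      (\<lambda>f g. \<forall>j\<in>{..<2 * J}. \<forall>i<2 ^ j. \<bar>schauder j i f - schauder j i g\<bar> \<le> mesh J j)
      (\<Sum>j<2 * J. 3 * 2 ^ J * (real (level_dist J j) + 1) * (2/3) ^ level_dist J j)"
    by (intro coverable_ball coverable_level) simp
  ultimately have cov: "coverable ?G
      (\<lambda>f g. code f = code g \<and>
        (\<forall>j\<in>{..<2 * J}. \<forall>i<2 ^ j. \<bar>schauder j i f - schauder j i g\<bar> \<le> mesh J j))
      (4 * 2 ^ J + (\<Sum>j<2 * J. 3 * 2 ^ J * (real (level_dist J j) + 1) * (2/3) ^ level_dist J j))"
    by (rule coverable_conj)
  have "(\<Sum>k<n. (real k + 1) * (2/3) ^ k) = 9 - (9 + 3 * real n) * (2/3) ^ n" for n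
    by (induction n) (simp_all add: algebra_simps add_divide_distrib)
  then have s1: "(\<Sum>k<n. (real k + 1) * (2/3) ^ k) \<le> 9" for n by simp
  have "(\<Sum>k<n. (3/4::real) ^ k) = 4 - 4 * (3/4) ^ n" for n
    by (induction n) (simp_all add: algebra_simps)
  then have s2: "(\<Sum>k<n. (3/4::real) ^ k) \<le> 4" for n by simp
  have "(\<Sum>j<2 * J. 3 * 2 ^ J * (real (level_dist J j) + 1) * (2/3) ^ level_dist J j)
      = 3 * 2 ^ J * (\<Sum>j<2 * J. (real (level_dist J j) + 1) * (2/3) ^ level_dist J j)"
    by (simp add: sum_distrib_left mult.assoc)
  also have "\<dots> \<le> 3 * 2 ^ J * (2 * 9)"
    by (intro mult_left_mono sum_level_dist_le[where \<phi> = "\<lambda>k. (real k + 1) * (2/3) ^ k"] s1) auto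
  finally have total: "4 * 2 ^ J
      + (\<Sum>j<2 * J. 3 * 2 ^ J * (real (level_dist J j) + 1) * (2/3) ^ level_dist J j) \<le> 58 * 2 ^ J"
    by simp
  have "(\<Sum>j<2 * J. mesh J j) = e * (\<Sum>j<2 * J. (3/4) ^ level_dist J j)"
    by (simp add: mesh_def e_def sum_distrib_left)
  also have "\<dots> \<le> e * (2 * 4)"
    using e by (intro mult_left_mono sum_level_dist_le s2) auto
  finally have mesh: "(\<Sum>j<2 * J. mesh J j) \<le> 8 * e" by simp
  show ?thesis
  proof (rule coverable_mono[OF cov _ total], intro ballI)
    fix f g and x :: real
    assume f: "f \<in> ?G" and g: "g \<in> ?G" and x: "x \<in> {0..1}"
      and fg: "code f = code g \<and>
        (\<forall>j\<in>{..<2 * J}. \<forall>i<2 ^ j. \<bar>schauder j i f - schauder j i g\<bar> \<le> mesh J j)"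
    \<comment> \<open>The grid point \<open>y\<close> is the left neighbour of \<open>x\<close>,
      less than one spacing away.\<close>
    define i where "i = nat \<lfloor>x * 2 ^ (2 * J)\<rfloor>"
    define y where "y = real i / 2 ^ (2 * J)"
    have i: "real i \<le> x * 2 ^ (2 * J)" "x * 2 ^ (2 * J) \<le> real i + 1"
      using x by (auto simp: i_def)
    have "x * 2 ^ (2 * J) \<le> 1 * 2 ^ (2 * J)" using x by (intro mult_right_mono) auto
    then have "real i \<le> 2 ^ (2 * J)" using i(1) by linarith
    then have "i \<le> 2 ^ (2 * J)" by (metis of_nat_le_iff of_nat_numeral of_nat_power)
    moreover have "\<bar>f 0 - g 0\<bar> \<le> e" "\<bar>f 1 - g 1\<bar> \<le> e"
      using fg f g e by (auto intro!: eq_nat_floor_divide_imp simp: code_def unit_concave_def)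
    ultimately have "\<bar>f y - g y\<bar> \<le> e + (\<Sum>j<2 * J. mesh J j)"
      unfolding y_def using fg by (intro dyadic_reconstruction) (auto simp: mesh_pos less_imp_le)
    moreover have y: "0 \<le> y" "y \<le> x" "x - y \<le> e"
    proof -
      have "e = 1 / 2 ^ (2 * J)" by (simp add: e_def power_mult power_one_over)
      then have "x - y \<le> e \<longleftrightarrow> x * 2 ^ (2 * J) \<le> real i + 1"
        unfolding y_def by (simp add: field_simps del: power_mult)
      then show "x - y \<le> e" using i(2) by simp
    qed (use i(1) in \<open>auto simp: y_def pos_divide_le_eq\<close>)
    have "\<bar>f x - f y\<bar> \<le> e" "\<bar>g x - g y\<bar> \<le> e"
      using unit_concave_lipschitz[OF f, of y x] unit_concave_lipschitz[OF g, of y x] x y by auto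
    ultimately show "\<bar>f x - g x\<bar> \<le> 11 * (1/4) ^ J" using mesh unfolding e_def by linarith
  qed
qed

text \<open>For \<open>\<eta> \<ge> 1\<close> one cell is enough. Otherwise the least admissible
  \<open>J\<close> is positive, and failure at \<open>J - 1\<close> gives
  \<open>2 ^ J \<le> 2 * sqrt (11 / \<eta>)\<close>; hence the constant
  \<open>116 = 2 * 58\<close>.\<close>

lemma coverable_uniform:
  obtains C :: real where "0 \<le> C"
    and "\<And>\<eta>. 0 < \<eta> \<Longrightarrow> coverable (unit_concave {-1..2})
           (\<lambda>f g. \<forall>x\<in>{0..1}. \<bar>f x - g x\<bar> \<le> \<eta>) (C * \<eta> powr (-1/2))"
proof
  fix \<eta> :: real assume \<eta>: "0 < \<eta>"
  show "coverable (unit_concave {-1..2})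
           (\<lambda>f g. \<forall>x\<in>{0..1}. \<bar>f x - g x\<bar> \<le> \<eta>) (116 * sqrt 11 * \<eta> powr (-1/2))"
  proof (cases "1 \<le> \<eta>")
    case True
    show ?thesis
    proof (rule coverable_mono[OF coverable_True])
      fix f g assume "f \<in> unit_concave {-1..2}" "g \<in> unit_concave {-1..2}"
      then have "\<bar>f x - g x\<bar> \<le> 1" if "x \<in> {0..1}" for x
        using that by (intro unit_concave_diff_le_1[of f "{-1..2}"]) auto
      then show "\<forall>x\<in>{0..1}. \<bar>f x - g x\<bar> \<le> \<eta>" using True by force
    qed simp
  next
    case False
    have "\<exists>J. 11 * (1/4) ^ J \<le> \<eta>"
    proof -
      obtain J where "(1/4::real) ^ J < \<eta> / 11" using real_arch_pow_inv[of "\<eta>/11" "1/4"] \<eta> by auto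
      then show ?thesis by (intro exI[of _ J]) simp
    qed
    then obtain J where J: "11 * (1/4) ^ J \<le> \<eta>" "\<And>i. i < J \<Longrightarrow> \<not> 11 * (1/4) ^ i \<le> \<eta>"
      using exists_least_iff[of "\<lambda>J. 11 * (1/4) ^ J \<le> \<eta>"] by blast
    have "J \<noteq> 0" using J(1) False by (intro notI) simp
    then obtain i where i: "J = Suc i" by (cases J) auto
    have "\<eta> < 11 * (1/4) ^ i" using J(2)[of i] i by simp
    then have "4 ^ i \<le> 11 / \<eta>" using \<eta> by (simp add: power_one_over field_simps)
    then have "sqrt (4 ^ i) \<le> sqrt (11 / \<eta>)" by (rule real_sqrt_le_mono)
    moreover have "sqrt (4 ^ i) = 2 ^ i"
      by (rule real_sqrt_unique) (simp_all add: power2_eq_square flip: power_mult_distrib)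
    ultimately have "58 * 2 ^ J \<le> 116 * sqrt (11 / \<eta>)" by (simp add: i)
    also have "\<dots> = 116 * sqrt 11 * \<eta> powr (-1/2)"
      using \<eta> by (simp add: real_sqrt_divide powr_minus_divide powr_half_sqrt)
    finally show ?thesis
      by (intro coverable_mono[OF coverable_uniform_dyadic[of J]]) (use J(1) in force)+
  qed
qed simp

subsection \<open>Peeling towards the end points\<close>

text \<open>On the \<open>k\<close>-th dyadic piece the tolerance grows like
  \<open>\<rho> ^ k\<close> with \<open>\<rho> = 2 powr a\<close>, still below the envelope there.
  The entropies then form a geometric series with ratio \<open>\<sigma> < 1\<close>, whose sum is
  bounded independently of the number of pieces.\<close>

lemma coverable_left:
  fixes a :: real
  assumes "0 < a"
  obtains C :: real where "0 \<le> C"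
    and "\<And>\<delta>. 0 < \<delta> \<Longrightarrow> coverable (unit_concave {0..1})
           (\<lambda>f g. \<forall>x\<in>{0<..1/2}. \<bar>f x - g x\<bar> \<le> \<delta> * x powr (-a)) (C * \<delta> powr (-1/2))"
proof -
  obtain C where C: "0 \<le> C"
    "\<And>\<eta>. 0 < \<eta> \<Longrightarrow> coverable (unit_concave {-1..2})
       (\<lambda>f g. \<forall>x\<in>{0..1}. \<bar>f x - g x\<bar> \<le> \<eta>) (C * \<eta> powr (-1/2))"
    using coverable_uniform by blast
  define \<rho> :: real where "\<rho> = 2 powr a"
  define \<sigma> where "\<sigma> = \<rho> powr (-1/2)"
  have \<rho>: "1 < \<rho>" using assms by (simp add: \<rho>_def)
  have \<sigma>: "0 < \<sigma>" "\<sigma> < 1" using \<rho> by (simp_all add: \<sigma>_def powr_less_one)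
  have powr_ge: "\<rho> ^ k \<le> x powr (-a)" if "0 < x" "x \<le> (1/2) ^ k" for k :: nat and x :: real
  proof -
    have "\<rho> ^ k = ((1/2) ^ k) powr (-a)"
      by (simp add: \<rho>_def powr_minus powr_power flip: powr_realpow powr_powr powr_divide)
         (simp add: powr_powr powr_divide powr_minus field_simps)
    also have "\<dots> \<le> x powr (-a)" using that assms by (intro powr_mono2') auto
    finally show ?thesis .
  qed
  show thesis
  proof (rule that)
    show "0 \<le> C / (1 - \<sigma>)" using C(1) \<sigma> by simp
    fix \<delta> :: real assume \<delta>: "0 < \<delta>"
    \<comment> \<open>For \<open>x \<le> (1/2) ^ K\<close> the envelope is at least
      \<open>\<delta> * \<rho> ^ K > 1\<close>, more than two members can differ by; so finitely
      many pieces need a cover.\<close>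
    obtain K where K: "1 / \<delta> < \<rho> ^ K" using real_arch_pow[OF \<rho>] by blast
    \<comment> \<open>The pieces are \<open>{p k..2 * p k}\<close>, beginning with
      \<open>{1/4..1/2}\<close>. Since \<open>p k \<le> 1/4\<close>, the map
      \<open>\<lambda>t. p k + p k * t\<close> sends \<open>{-1..2}\<close> into
      \<open>{0..1}\<close>, which supplies the margins for the uniform bound.\<close>
    define p :: "nat \<Rightarrow> real" where "p k = (1/2) ^ (k + 2)" for k
    define \<eta> where "\<eta> k = \<delta> * \<rho> ^ k" for k
    have \<eta>: "0 < \<eta> k" for k using \<delta> \<rho> by (simp add: \<eta>_def)
    define R where "R k f g \<longleftrightarrow> (\<forall>t\<in>{0..1}. \<bar>f (p k + p k * t) - g (p k + p k * t)\<bar> \<le> \<eta> k)"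
      for k and f g :: "real \<Rightarrow> real"
    have cov: "coverable (unit_concave {0..1}) (R k) (C * \<eta> k powr (-1/2))" for k
    proof (rule coverable_pullback[OF C(2)[OF \<eta>[of k]], where T = "\<lambda>f t. f (p k + p k * t)"])
      show "(\<lambda>f t. f (p k + p k * t)) ` unit_concave {0..1} \<subseteq> unit_concave {-1..2}"
      proof (intro image_subsetI unit_concave_affine)
        fix t :: real assume t: "t \<in> {-1..2}"
        have p: "0 < p k" "p k \<le> 1/4" by (simp_all add: p_def power_le_one)
        have "p k * (1 + t) \<le> 1/4 * 3" using p t by (intro mult_mono) auto
        moreover have "0 \<le> p k * (1 + t)" using p t by simp
        ultimately show "p k + p k * t \<in> {0..1}" by (simp add: algebra_simps)
      qed auto
    qed (auto simp: R_def)
    have "(\<Sum>k\<in>{..K}. C * \<eta> k powr (-1/2)) = C * \<delta> powr (-1/2) * (\<Sum>k\<in>{..K}. \<sigma> ^ k)"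
    proof -
      have "(\<rho> ^ k) powr (-1/2) = \<sigma> ^ k" for k
        using \<rho> by (simp add: \<sigma>_def powr_power powr_powr mult.commute flip: powr_realpow)
      then show ?thesis using \<delta> \<rho> by (simp add: \<eta>_def powr_mult sum_distrib_left mult.assoc)
    qed
    also have "\<dots> \<le> C * \<delta> powr (-1/2) * (1 / (1 - \<sigma>))"
    proof (intro mult_left_mono)
      have "(\<Sum>k\<in>{..K}. \<sigma> ^ k) = (1 - \<sigma> ^ Suc K) / (1 - \<sigma>)"
        using sum_gp0[of \<sigma> K] \<sigma> by simp
      also have "\<dots> \<le> 1 / (1 - \<sigma>)" using \<sigma> by (intro divide_right_mono) auto
      finally show "(\<Sum>k\<in>{..K}. \<sigma> ^ k) \<le> 1 / (1 - \<sigma>)" .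
    qed (use C(1) in simp)
    finally have sum: "(\<Sum>k\<in>{..K}. C * \<eta> k powr (-1/2)) \<le> C / (1 - \<sigma>) * \<delta> powr (-1/2)" by simp
    show "coverable (unit_concave {0..1})
           (\<lambda>f g. \<forall>x\<in>{0<..1/2}. \<bar>f x - g x\<bar> \<le> \<delta> * x powr (-a)) (C / (1 - \<sigma>) * \<delta> powr (-1/2))"
    proof (rule coverable_mono[OF coverable_ball[OF finite_atMost cov] _ sum], intro ballI)
      fix f g and x :: real
      assume f: "f \<in> unit_concave {0..1}" and g: "g \<in> unit_concave {0..1}"
        and R: "\<forall>k\<in>{..K}. R k f g" and x: "x \<in> {0<..1/2}"
      show "\<bar>f x - g x\<bar> \<le> \<delta> * x powr (-a)"
      proof (cases "x \<le> (1/2) ^ K")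
        case True
        then have "\<rho> ^ K \<le> x powr (-a)" using x by (intro powr_ge) auto
        then have "1 / \<delta> \<le> x powr (-a)" using K by linarith
        then have "1 \<le> \<delta> * x powr (-a)" using \<delta> by (simp add: field_simps)
        moreover have "\<bar>f x - g x\<bar> \<le> 1" using x by (intro unit_concave_diff_le_1[OF f g]) auto
        ultimately show ?thesis by linarith
      next
        case False
        have "p K \<le> (1/2) ^ K" unfolding p_def by (intro power_decreasing) auto
        then have "p K \<le> x" using False by linarith
        then obtain k where k: "p k \<le> x" "\<And>i. i < k \<Longrightarrow> \<not> p i \<le> x" and "k \<le> K"
          using exists_least_iff[of "\<lambda>k. p k \<le> x"] by (metis not_le)
        \<comment> \<open>Minimality of \<open>k\<close> puts \<open>x\<close> below the previous
          \<open>p\<close>, which is \<open>2 * p k\<close>; for \<open>k = 0\<close> the assumption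
          \<open>x \<le> 1/2\<close> takes its place.\<close>
        have x2: "x \<le> (1/2) ^ Suc k"
        proof (cases k)
          case 0
          then show ?thesis using x by simp
        next
          case (Suc i)
          then show ?thesis using k(2)[of i] by (simp add: p_def)
        qed
        have pk: "0 < p k" by (simp add: p_def)
        define t where "t = x / p k - 1"
        have "x \<le> 2 * p k" using x2 by (simp add: p_def)
        then have t: "t \<in> {0..1}" "p k + p k * t = x"
          using k(1) pk by (auto simp: t_def field_simps)
        have "\<bar>f x - g x\<bar> \<le> \<eta> k"
          using R \<open>k \<le> K\<close> t unfolding R_def by (metis atMost_iff)
        also have "\<dots> \<le> \<delta> * x powr (-a)"
        proof -
          have "(1/2) ^ Suc k \<le> (1/2 :: real) ^ k" by simp
          then have "\<rho> ^ k \<le> x powr (-a)" using x x2 by (intro powr_ge) auto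
          then show ?thesis unfolding \<eta>_def using \<delta> by simp
        qed
        finally show ?thesis .
      qed
    qed
  qed
qed

text \<open>The reflection \<open>\<lambda>t. 1 - t\<close> preserves the class and exchanges the
  two halves; the sum of the two envelopes dominates each of them.\<close>

lemma coverable_unit:
  fixes a :: real
  assumes "0 < a"
  obtains C :: real where "0 \<le> C"
    and "\<And>\<delta>. 0 < \<delta> \<Longrightarrow> coverable (unit_concave {0..1})
           (\<lambda>f g. \<forall>x\<in>{0<..<1}. \<bar>f x - g x\<bar> \<le> \<delta> * (x powr (-a) + (1 - x) powr (-a)))
           (C * \<delta> powr (-1/2))"
proof -
  obtain C where C: "0 \<le> C"
    "\<And>\<delta>. 0 < \<delta> \<Longrightarrow> coverable (unit_concave {0..1})
       (\<lambda>f g. \<forall>x\<in>{0<..1/2}. \<bar>f x - g x\<bar> \<le> \<delta> * x powr (-a)) (C * \<delta> powr (-1/2))"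
    using coverable_left[OF assms] by blast
  show thesis
  proof (rule that)
    show "0 \<le> 2 * C" using C(1) by simp
    fix \<delta> :: real assume \<delta>: "0 < \<delta>"
    have "coverable (unit_concave {0..1})
       (\<lambda>f g. \<forall>x\<in>{0<..1/2}. \<bar>f (1 - x) - g (1 - x)\<bar> \<le> \<delta> * x powr (-a)) (C * \<delta> powr (-1/2))"
    proof (rule coverable_pullback[OF C(2)[OF \<delta>], where T = "\<lambda>f t. f (1 + (-1) * t)"])
      show "(\<lambda>f t. f (1 + (-1) * t)) ` unit_concave {0..1} \<subseteq> unit_concave {0..1}"
        by (intro image_subsetI unit_concave_affine) auto
    qed auto
    from coverable_conj[OF C(2)[OF \<delta>] this]
    show "coverable (unit_concave {0..1})
           (\<lambda>f g. \<forall>x\<in>{0<..<1}. \<bar>f x - g x\<bar> \<le> \<delta> * (x powr (-a) + (1 - x) powr (-a)))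
           (2 * C * \<delta> powr (-1/2))"
    proof (rule coverable_mono, intro ballI)
      fix f g :: "real \<Rightarrow> real" and x :: real
      assume *: "(\<forall>x\<in>{0<..1/2}. \<bar>f x - g x\<bar> \<le> \<delta> * x powr (-a)) \<and>
        (\<forall>x\<in>{0<..1/2}. \<bar>f (1 - x) - g (1 - x)\<bar> \<le> \<delta> * x powr (-a))" and x: "x \<in> {0<..<1}"
      have nn: "0 \<le> \<delta> * x powr (-a)" "0 \<le> \<delta> * (1 - x) powr (-a)" using \<delta> by simp_all
      have "\<bar>f x - g x\<bar> \<le> \<delta> * x powr (-a) \<or> \<bar>f x - g x\<bar> \<le> \<delta> * (1 - x) powr (-a)"
      proof (cases "x \<le> 1/2")
        case True
        then show ?thesis using * x by simp
      next
        case False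
        then have "1 - x \<in> {0<..1/2}" using x by simp
        then show ?thesis using *[THEN conjunct2, rule_format, of "1 - x"] by simp
      qed
      then show "\<bar>f x - g x\<bar> \<le> \<delta> * (x powr (-a) + (1 - x) powr (-a))"
        using nn unfolding distrib_left by linarith
    qed simp
  qed
qed

section \<open>Transfer to the class on a general interval\<close>

text \<open>The bounds exclude both infinities on \<open>{b1..b2}\<close>, so
  \<open>real_of_ereal\<close> is faithful there; outside it would turn the value
  \<open>-\<infinity>\<close> into the default 0.\<close>

lemma concave_class_real:
  assumes "\<phi> \<in> concave_class b1 b2 B"
  shows "x \<in> {b1..b2} \<Longrightarrow> ereal (real_of_ereal (\<phi> x)) = \<phi> x"
    and "x \<in> {b1..b2} \<Longrightarrow> - B \<le> real_of_ereal (\<phi> x) \<and> real_of_ereal (\<phi> x) \<le> B"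
    and "concave_on {b1..b2} (\<lambda>x. real_of_ereal (\<phi> x))"
proof -
  have bnd: "ereal (- B) \<le> \<phi> x \<and> \<phi> x \<le> ereal B" if "x \<in> {b1..b2}" for x
    using assms that by (auto simp: concave_class_def)
  show real: "ereal (real_of_ereal (\<phi> x)) = \<phi> x" if "x \<in> {b1..b2}" for x
    using bnd[OF that] by (cases "\<phi> x") auto
  show "- B \<le> real_of_ereal (\<phi> x) \<and> real_of_ereal (\<phi> x) \<le> B" if "x \<in> {b1..b2}" for x
    using bnd[OF that] by (cases "\<phi> x") auto
  show "concave_on {b1..b2} (\<lambda>x. real_of_ereal (\<phi> x))"
    unfolding concave_on_iff
  proof (intro conjI ballI allI impI)
    fix x y u v :: real
    assume *: "x \<in> {b1..b2}" "y \<in> {b1..b2}" "0 \<le> u" "0 \<le> v" "u + v = 1"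
    have z: "u *\<^sub>R x + v *\<^sub>R y \<in> {b1..b2}"
      using * convex_real_interval(5)[of b1 b2] unfolding convex_def by blast
    have "ereal u * \<phi> x + ereal v * \<phi> y \<le> \<phi> (u *\<^sub>R x + v *\<^sub>R y)"
      using assms * by (simp add: concave_class_def proper_concave_def ereal_concave_def)
    then have "ereal u * ereal (real_of_ereal (\<phi> x)) + ereal v * ereal (real_of_ereal (\<phi> y))
        \<le> ereal (real_of_ereal (\<phi> (u *\<^sub>R x + v *\<^sub>R y)))"
      unfolding real[OF z] real[OF *(1)] real[OF *(2)] .
    then show "u * real_of_ereal (\<phi> x) + v * real_of_ereal (\<phi> y)
        \<le> real_of_ereal (\<phi> (u *\<^sub>R x + v *\<^sub>R y))" by simp
  qed simp
qed

text \<open>The map \<open>T\<close> rescales both axes affinely to \<open>{0..1}\<close>; undoing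
  the scaling of the values produces the factor \<open>2 * B\<close>.\<close>

lemma coverable_concave_class:
  fixes a B b1 b2 :: real
  assumes "0 < a" "0 < B" "b1 < b2"
  obtains C :: real where "0 \<le> C"
    and "\<And>\<delta>. 0 < \<delta> \<Longrightarrow> coverable (concave_class b1 b2 B)
           (\<lambda>\<phi> \<psi>. \<forall>x\<in>{b1<..<b2}. \<bar>real_of_ereal (\<phi> x) - real_of_ereal (\<psi> x)\<bar>
              \<le> 2 * B * \<delta> * (((x - b1) / (b2 - b1)) powr (-a) + ((b2 - x) / (b2 - b1)) powr (-a)))
           (C * \<delta> powr (-1/2))"
proof -
  define c where "c = b2 - b1"
  have c: "0 < c" using assms by (simp add: c_def)
  obtain C where C: "0 \<le> C"
    "\<And>\<delta>. 0 < \<delta> \<Longrightarrow> coverable (unit_concave {0..1})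
       (\<lambda>f g. \<forall>x\<in>{0<..<1}. \<bar>f x - g x\<bar> \<le> \<delta> * (x powr (-a) + (1 - x) powr (-a)))
       (C * \<delta> powr (-1/2))"
    using coverable_unit[OF assms(1)] by blast
  define T where "T \<phi> t = (real_of_ereal (\<phi> (b1 + c * t)) + B) / (2 * B)"
    for \<phi> :: "real \<Rightarrow> ereal" and t
  have T: "T \<phi> \<in> unit_concave {0..1}" if \<phi>: "\<phi> \<in> concave_class b1 b2 B" for \<phi>
  proof -
    have dom: "b1 + c * t \<in> {b1..b2}" if "t \<in> {0..1}" for t
    proof -
      have "c * t \<le> c * 1" using that c by (intro mult_left_mono) auto
      moreover have "0 \<le> c * t" using that c by simp
      ultimately show ?thesis using c_def by simp
    qed
    have "concave_on {0..1} (\<lambda>t. real_of_ereal (\<phi> (b1 + c * t)))"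
      by (rule concave_on_affine[OF concave_class_real(3)[OF \<phi>] _ dom]) auto
    then have "concave_on {0..1} (\<lambda>t. (1 / (2 * B)) * (real_of_ereal (\<phi> (b1 + c * t)) + B))"
      using assms(2) by (intro concave_on_cmul concave_on_add) (auto simp: concave_on_const)
    then have "concave_on {0..1} (T \<phi>)" by (simp add: T_def[abs_def])
    moreover have "0 \<le> T \<phi> t \<and> T \<phi> t \<le> 1" if "t \<in> {0..1}" for t
      using concave_class_real(2)[OF \<phi> dom[OF that]] assms(2) by (simp add: T_def)
    ultimately show ?thesis by (simp add: unit_concave_def)
  qed
  show thesis
  proof (rule that[OF C(1)])
    fix \<delta> :: real assume "0 < \<delta>"
    show "coverable (concave_class b1 b2 B)
           (\<lambda>\<phi> \<psi>. \<forall>x\<in>{b1<..<b2}. \<bar>real_of_ereal (\<phi> x) - real_of_ereal (\<psi> x)\<bar>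
              \<le> 2 * B * \<delta> * (((x - b1) / (b2 - b1)) powr (-a) + ((b2 - x) / (b2 - b1)) powr (-a)))
           (C * \<delta> powr (-1/2))"
    proof (rule coverable_pullback[OF C(2)[OF \<open>0 < \<delta>\<close>], where T = T], use T in blast, intro ballI)
      fix \<phi> \<psi> and x :: real
      assume R: "\<forall>x\<in>{0<..<1}. \<bar>T \<phi> x - T \<psi> x\<bar> \<le> \<delta> * (x powr (-a) + (1 - x) powr (-a))"
        and x: "x \<in> {b1<..<b2}"
      define t where "t = (x - b1) / c"
      have t: "t \<in> {0<..<1}" "b1 + c * t = x" "1 - t = (b2 - x) / c"
        using x c by (auto simp: t_def c_def field_simps)
      have "T \<phi> t - T \<psi> t = (real_of_ereal (\<phi> x) - real_of_ereal (\<psi> x)) / (2 * B)"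
        by (simp add: T_def t(2) diff_divide_distrib add_divide_distrib)
      then have "\<bar>real_of_ereal (\<phi> x) - real_of_ereal (\<psi> x)\<bar> = 2 * B * \<bar>T \<phi> t - T \<psi> t\<bar>"
        using assms(2) by (simp add: abs_divide abs_mult)
      also have "\<dots> \<le> 2 * B * (\<delta> * (t powr (-a) + (1 - t) powr (-a)))"
        using R t(1) assms(2) by (intro mult_left_mono) auto
      finally show "\<bar>real_of_ereal (\<phi> x) - real_of_ereal (\<psi> x)\<bar>
          \<le> 2 * B * \<delta> * (((x - b1) / (b2 - b1)) powr (-a) + ((b2 - x) / (b2 - b1)) powr (-a))"
        unfolding t(3) by (simp add: t_def c_def mult.assoc)
    qed simp
  qed
qed

subsection \<open>From covers to brackets\<close>

text \<open>One representative from \<open>F\<close> in each cell suffices: its bracket contains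
  every member of \<open>F\<close> in the same cell.\<close>

lemma ln_bracketing_number_le:
  assumes "coverable F R c"
    and "\<And>f. f \<in> F \<Longrightarrow> eps_bracket_pair \<epsilon> r S (l f) (u f)"
    and "\<And>f g. f \<in> F \<Longrightarrow> g \<in> F \<Longrightarrow> R f g \<Longrightarrow> g \<in> bracket S (l f) (u f)"
  shows "ln_enat (bracketing_number \<epsilon> r S F) \<le> ereal c"
proof -
  obtain P where P: "finite P" "F \<subseteq> \<Union>P" "real (card P) \<le> exp c"
    "\<forall>A\<in>P. \<forall>f\<in>A. \<forall>g\<in>A. R f g"
    using assms(1) unfolding coverable_def by blast
  \<comment> \<open>Cells that miss \<open>F\<close> have no representative and are dropped.\<close>
  define P' where "P' = {A \<in> P. A \<inter> F \<noteq> {}}"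
  define rep where "rep A = (SOME f. f \<in> A \<inter> F)" for A
  have rep: "rep A \<in> A \<inter> F" if "A \<in> P'" for A
    using that unfolding P'_def rep_def by (metis (mono_tags, lifting) ex_in_conv mem_Collect_eq someI)
  define Q where "Q = (\<lambda>A. (l (rep A), u (rep A))) ` P'"
  have P': "finite P'" "P' \<subseteq> P" using P(1) by (auto simp: P'_def)
  have "card Q \<le> card P'" unfolding Q_def by (rule card_image_le[OF P'(1)])
  also have "\<dots> \<le> card P" by (rule card_mono[OF P(1) P'(2)])
  finally have card: "real (card Q) \<le> exp c" using P(3) by linarith
  have "finite Q" using P'(1) by (simp add: Q_def)
  moreover have "\<forall>(l, u)\<in>Q. eps_bracket_pair \<epsilon> r S l u"
    using assms(2) rep by (auto simp: Q_def)
  moreover have "F \<subseteq> (\<Union>(l, u)\<in>Q. bracket S l u)"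
  proof
    fix g assume g: "g \<in> F"
    then obtain A where A: "A \<in> P" "g \<in> A" using P(2) by blast
    then have A': "A \<in> P'" using g by (auto simp: P'_def)
    then have "R (rep A) g" using rep P(4) A by blast
    then have "g \<in> bracket S (l (rep A)) (u (rep A))" using assms(3) rep[OF A'] g by blast
    then show "g \<in> (\<Union>(l, u)\<in>Q. bracket S l u)" using A' unfolding Q_def by blast
  qed
  ultimately have "bracketing_number \<epsilon> r S F \<le> enat (card Q)"
    unfolding bracketing_number_def by (intro Inf_lower) blast
  then obtain n where n: "bracketing_number \<epsilon> r S F = enat n" "n \<le> card Q"
    by (cases "bracketing_number \<epsilon> r S F") auto
  show ?thesis
  proof (cases "n = 0")
    case False
    then have "ln (real n) \<le> ln (exp c)"
      using n(2) card by (subst ln_le_cancel_iff) auto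
    then show ?thesis using False by (simp add: n ln_enat_def)
  qed (simp add: n ln_enat_def)
qed

section \<open>Integrability of the envelope and size of the brackets\<close>

text \<open>The antiderivative \<open>W\<close> is continuous on the closed interval although its
  derivative blows up at both ends, so the fundamental theorem with interior derivatives
  applies.\<close>

lemma inverse_sqrt_weight:
  fixes b1 b2 :: real
  assumes "b1 < b2"
  defines "w \<equiv> \<lambda>x. ((x - b1) / (b2 - b1)) powr (-1/2) + ((b2 - x) / (b2 - b1)) powr (-1/2)"
  shows "integrable (lebesgue_on {b1..b2}) w" and "integral\<^sup>L (lebesgue_on {b1..b2}) w = 4 * (b2 - b1)"
proof -
  define c where "c = b2 - b1"
  have c: "0 < c" using assms by (simp add: c_def)
  define W where "W x = 2 * c * (sqrt ((x - b1) / c) - sqrt ((b2 - x) / c))" for x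
  have "(w has_integral (W b2 - W b1)) {b1..b2}"
  proof (rule fundamental_theorem_of_calculus_interior)
    show "continuous_on {b1..b2} W" unfolding W_def by (intro continuous_intros) (use c in auto)
    fix x assume x: "x \<in> {b1<..<b2}"
    have p: "0 < (x - b1) / c" "0 < (b2 - x) / c" using x c by auto
    have "(W has_real_derivative
        2 * c * (1 / c * (inverse (sqrt ((x - b1) / c)) / 2)
          - (- 1 / c) * (inverse (sqrt ((b2 - x) / c)) / 2))) (at x)"
      unfolding W_def using p c by (auto intro!: derivative_eq_intros simp: field_simps)
    also have "2 * c * (1 / c * (inverse (sqrt ((x - b1) / c)) / 2)
          - (- 1 / c) * (inverse (sqrt ((b2 - x) / c)) / 2)) = w x"
    proof -
      have "y powr (-1/2) = inverse (sqrt y)" if "0 < y" for y :: real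
        using powr_minus[of y "1/2"] that by (simp add: powr_half_sqrt)
      then have "w x = inverse (sqrt ((x - b1) / c)) + inverse (sqrt ((b2 - x) / c))"
        using p unfolding w_def c_def by simp
      then show ?thesis using c by (simp add: algebra_simps)
    qed
    finally show "(W has_vector_derivative w x) (at x)"
      by (simp add: has_real_derivative_iff_has_vector_derivative)
  qed (use assms in simp)
  moreover have "W b2 - W b1 = 4 * (b2 - b1)" using c by (simp add: W_def flip: c_def)
  ultimately have W: "(w has_integral 4 * (b2 - b1)) {b1..b2}" by simp
  \<comment> \<open>Nonnegativity upgrades gauge integrability to Lebesgue integrability.\<close>
  then have "w absolutely_integrable_on {b1..b2}"
    by (intro nonnegative_absolutely_integrable_1 has_integral_integrable) (auto simp: w_def)
  then show int: "integrable (lebesgue_on {b1..b2}) w"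
    by (rule absolutely_integrable_imp_integrable) simp
  show "integral\<^sup>L (lebesgue_on {b1..b2}) w = 4 * (b2 - b1)"
    using lebesgue_integral_eq_integral[OF int] integral_unique[OF W] by simp
qed

text \<open>The envelope blows up at the end points, where \<open>0 powr s = 0\<close> would make it useless; there
  the brackets take the trivial values \<open>-B\<close> and \<open>B\<close>.\<close>

lemma eps_bracket_pair_envelope:
  fixes r b1 b2 K B :: real
  assumes "1 \<le> r" "b1 < b2" "0 \<le> K" and m: "continuous_on {b1<..<b2} m"
  defines "h \<equiv> \<lambda>x. K * (((x - b1) / (b2 - b1)) powr (- (1 / (2 * r)))
                   + ((b2 - x) / (b2 - b1)) powr (- (1 / (2 * r))))"
  shows "eps_bracket_pair (4 * K * (4 * (b2 - b1)) powr (1 / r)) r {b1..b2}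
           (\<lambda>x. if x \<in> {b1<..<b2} then m x - h x else - B)
           (\<lambda>x. if x \<in> {b1<..<b2} then m x + h x else B)"
    (is "eps_bracket_pair _ _ _ ?l ?u")
proof -
  let ?M = "lebesgue_on {b1..b2}"
  let ?w = "\<lambda>x. ((x - b1) / (b2 - b1)) powr (-1/2) + ((b2 - x) / (b2 - b1)) powr (-1/2)"
  have h: "continuous_on {b1<..<b2} h"
    unfolding h_def by (intro continuous_intros) (use assms in auto)
  have "?l \<in> borel_measurable borel" "?u \<in> borel_measurable borel"
    by (intro borel_measurable_continuous_on_if continuous_intros m h; simp)+
  then have meas: "?l \<in> borel_measurable ?M" "?u \<in> borel_measurable ?M"
    by (simp_all add: measurable_completion measurable_restrict_space1)
  have bound: "\<bar>?l x - ?u x\<bar> powr r \<le> (4 * K) powr r * ?w x" if x: "x \<in> {b1<..<b2}" for x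
  proof -
    define p where "p = ((x - b1) / (b2 - b1)) powr (- (1 / (2 * r)))"
    define q where "q = ((b2 - x) / (b2 - b1)) powr (- (1 / (2 * r)))"
    have pq: "0 \<le> p" "0 \<le> q" by (auto simp: p_def q_def)
    have "p powr r = ((x - b1) / (b2 - b1)) powr (-1/2)" "q powr r = ((b2 - x) / (b2 - b1)) powr (-1/2)"
      using assms(1) by (auto simp: p_def q_def powr_powr)
    then have w: "?w x = p powr r + q powr r" by simp
    have "\<bar>?l x - ?u x\<bar> = 2 * (K * (p + q))"
      using x pq assms(3) by (simp add: h_def p_def q_def)
    \<comment> \<open>The maximum is used because its \<open>r\<close>-th power is at most
      \<open>p powr r + q powr r\<close>. In the factor 4, one 2 comes from the two sides of the
      bracket and the other from the maximum.\<close>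
    also have "\<dots> \<le> 2 * (K * (2 * max p q))"
      using assms(3) by (intro mult_left_mono) auto
    finally have "\<bar>?l x - ?u x\<bar> powr r \<le> (4 * K * max p q) powr r"
      using assms(1) by (intro powr_mono2) auto
    also have "\<dots> = (4 * K) powr r * max p q powr r"
      by (rule powr_mult)
    also have "\<dots> \<le> (4 * K) powr r * (p powr r + q powr r)"
      by (intro mult_left_mono) (auto simp: max_def)
    finally show ?thesis by (simp only: w)
  qed
  \<comment> \<open>At the end points the difference is \<open>\<bar>2 * B\<bar>\<close>, which the
    weight need not dominate; they form a null set.\<close>
  have ae: "AE x in ?M. \<bar>?l x - ?u x\<bar> powr r \<le> (4 * K) powr r * ?w x"
  proof -
    have "AE x in lebesgue. x \<noteq> b1 \<and> x \<noteq> b2"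
      by (intro AE_completion AE_conjI AE_lborel_singleton)
    then have "AE x in lebesgue. x \<in> {b1..b2} \<longrightarrow> \<bar>?l x - ?u x\<bar> powr r \<le> (4 * K) powr r * ?w x"
    proof eventually_elim
      case (elim x)
      show ?case
      proof
        assume "x \<in> {b1..b2}"
        then have "x \<in> {b1<..<b2}" using elim by auto
        then show "\<bar>?l x - ?u x\<bar> powr r \<le> (4 * K) powr r * ?w x" by (rule bound)
      qed
    qed
    then show ?thesis by (subst AE_restrict_space_iff) auto
  qed
  have wint: "integrable ?M (\<lambda>x. (4 * K) powr r * ?w x)"
    by (intro integrable_mult_right inverse_sqrt_weight(1) assms)
  have int: "integrable ?M (\<lambda>x. \<bar>?l x - ?u x\<bar> powr r)"
  proof (rule Bochner_Integration.integrable_bound[OF wint])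
    show "(\<lambda>x. \<bar>?l x - ?u x\<bar> powr r) \<in> borel_measurable ?M" using meas by measurable
    show "AE x in ?M. norm (\<bar>?l x - ?u x\<bar> powr r) \<le> norm ((4 * K) powr r * ?w x)"
      using ae by eventually_elim (simp add: abs_of_nonneg)
  qed
  have "(LINT x|?M. \<bar>?l x - ?u x\<bar> powr r) \<le> (LINT x|?M. (4 * K) powr r * ?w x)"
    by (rule integral_mono_AE[OF int wint ae])
  also have "\<dots> = (4 * K) powr r * (4 * (b2 - b1))"
    using inverse_sqrt_weight(2)[OF assms(2)] by simp
  finally have "Lr_dist r {b1..b2} ?l ?u \<le> ((4 * K) powr r * (4 * (b2 - b1))) powr (1 / r)"
    unfolding Lr_dist_def using assms(1) by (intro powr_mono2 integral_nonneg_AE) auto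
  also have "\<dots> = 4 * K * (4 * (b2 - b1)) powr (1 / r)"
    using assms by (subst powr_mult) (auto simp: powr_powr)
  finally show ?thesis unfolding eps_bracket_pair_def using meas int by blast
qed

theorem proposition4p1:
  fixes r B b1 b2 :: real
  assumes "1 \<le> r" and "0 < B" and "b1 < b2"
  shows "\<exists>C::real. \<forall>\<epsilon>>0.
           ln_enat (bracketing_number \<epsilon> r {b1..b2} (concave_class b1 b2 B))
             \<le> ereal (C * (B * (b2 - b1) powr (1 / r) / \<epsilon>) powr (1 / 2))"
proof -
  let ?F = "concave_class b1 b2 B"
  \<comment> \<open>The \<open>r\<close>-th power of the envelope then blows up like an inverse
    square root and stays integrable.\<close>
  define a where "a = 1 / (2 * r)"
  have "0 < a" using assms(1) by (simp add: a_def)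
  define w where "w x = ((x - b1) / (b2 - b1)) powr (-a) + ((b2 - x) / (b2 - b1)) powr (-a)" for x
  obtain C where C: "\<And>\<delta>. 0 < \<delta> \<Longrightarrow> coverable ?F
      (\<lambda>\<phi> \<psi>. \<forall>x\<in>{b1<..<b2}. \<bar>real_of_ereal (\<phi> x) - real_of_ereal (\<psi> x)\<bar> \<le> 2 * B * \<delta> * w x)
      (C * \<delta> powr (-1/2))"
    using coverable_concave_class[OF \<open>0 < a\<close> assms(2,3)] unfolding w_def by blast
  \<comment> \<open>The envelope with \<open>K = 2 * B * \<delta>\<close> gives brackets of size
    \<open>D * B * \<delta> * (b2 - b1) powr (1 / r)\<close>.\<close>
  define D where "D = 8 * 4 powr (1 / r)"
  have D: "0 < D" by (simp add: D_def)
  show ?thesis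
  proof (intro exI[of _ "C * D powr (1/2)"] allI impI)
    fix \<epsilon> :: real assume \<epsilon>: "0 < \<epsilon>"
    define E where "E = B * (b2 - b1) powr (1 / r) / \<epsilon>"
    have E: "0 < E" using assms \<epsilon> by (simp add: E_def)
    \<comment> \<open>This value makes the bracket size exactly \<open>\<epsilon>\<close>, and turns
      \<open>\<delta> powr (-1/2)\<close> into a constant times \<open>E powr (1/2)\<close>.\<close>
    define \<delta> where "\<delta> = 1 / (D * E)"
    have \<delta>: "0 < \<delta>" using D E by (simp add: \<delta>_def)
    have \<epsilon>_eq: "4 * (2 * B * \<delta>) * (4 * (b2 - b1)) powr (1 / r) = \<epsilon>"
    proof -
      have "(4 * (b2 - b1)) powr (1 / r) = 4 powr (1 / r) * (b2 - b1) powr (1 / r)"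
        by (rule powr_mult)
      then have "4 * (2 * B * \<delta>) * (4 * (b2 - b1)) powr (1 / r) = D * (E * \<epsilon>) * \<delta>"
        using \<epsilon> by (simp add: D_def E_def)
      then show ?thesis using D E by (simp add: \<delta>_def)
    qed
    define l where "l \<phi> x =
        (if x \<in> {b1<..<b2} then real_of_ereal (\<phi> x) - 2 * B * \<delta> * w x else - B)"
      for \<phi> :: "real \<Rightarrow> ereal" and x
    define u where "u \<phi> x =
        (if x \<in> {b1<..<b2} then real_of_ereal (\<phi> x) + 2 * B * \<delta> * w x else B)"
      for \<phi> :: "real \<Rightarrow> ereal" and x
    have "ln_enat (bracketing_number \<epsilon> r {b1..b2} ?F) \<le> ereal (C * \<delta> powr (-1/2))"
    proof (rule ln_bracketing_number_le[OF C[OF \<delta>], where l = l and u = u])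
      fix \<phi> assume \<phi>: "\<phi> \<in> ?F"
      \<comment> \<open>Convexity of the negative yields continuity on the open interval, which is
        what the envelope brackets ask of their centre.\<close>
      have "convex_on {b1<..<b2} (\<lambda>x. - real_of_ereal (\<phi> x))"
        using concave_class_real(3)[OF \<phi>] unfolding concave_on_def
        by (rule convex_on_subset) auto
      then have "continuous_on {b1<..<b2} (\<lambda>x. - real_of_ereal (\<phi> x))"
        by (intro convex_on_continuous) auto
      then have "continuous_on {b1<..<b2} (\<lambda>x. - (- real_of_ereal (\<phi> x)))"
        by (rule continuous_on_minus)
      then have "continuous_on {b1<..<b2} (\<lambda>x. real_of_ereal (\<phi> x))" by simp
      from eps_bracket_pair_envelope[OF assms(1,3) _ this, of "2 * B * \<delta>" B]
      show "eps_bracket_pair \<epsilon> r {b1..b2} (l \<phi>) (u \<phi>)"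
        using assms(2) \<delta> unfolding \<epsilon>_eq l_def[abs_def] u_def[abs_def] w_def a_def by simp
    next
      fix \<phi> \<psi> assume \<phi>: "\<phi> \<in> ?F" and \<psi>: "\<psi> \<in> ?F"
        and R: "\<forall>x\<in>{b1<..<b2}. \<bar>real_of_ereal (\<phi> x) - real_of_ereal (\<psi> x)\<bar> \<le> 2 * B * \<delta> * w x"
      have "ereal (l \<phi> x) \<le> \<psi> x \<and> \<psi> x \<le> ereal (u \<phi> x)" if x: "x \<in> {b1..b2}" for x
      proof -
        have "l \<phi> x \<le> real_of_ereal (\<psi> x) \<and> real_of_ereal (\<psi> x) \<le> u \<phi> x"
        proof (cases "x \<in> {b1<..<b2}")
          case True
          then show ?thesis using R[rule_format, OF True] by (simp add: l_def u_def abs_le_iff)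
        next
          case False
          then have "l \<phi> x = - B" "u \<phi> x = B" unfolding l_def u_def by (simp_all only: if_False)
          then show ?thesis using concave_class_real(2)[OF \<psi> x] by (simp only:)
        qed
        then have "ereal (l \<phi> x) \<le> ereal (real_of_ereal (\<psi> x))
            \<and> ereal (real_of_ereal (\<psi> x)) \<le> ereal (u \<phi> x)" by simp
        then show ?thesis unfolding concave_class_real(1)[OF \<psi> x] .
      qed
      then show "\<psi> \<in> bracket {b1..b2} (l \<phi>) (u \<phi>)" by (simp add: bracket_def)
    qed
    also have "\<delta> powr (-1/2) = D powr (1/2) * E powr (1/2)"
      using D E by (simp add: \<delta>_def powr_minus_divide powr_divide powr_mult)
    finally show "ln_enat (bracketing_number \<epsilon> r {b1..b2} ?F)
        \<le> ereal (C * D powr (1/2) * (B * (b2 - b1) powr (1 / r) / \<epsilon>) powr (1/2))"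
      by (simp add: E_def mult.assoc)
  qed
qed

end
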